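(* Consider the equation $$7x^2+59y^2=3^m$$ in non-zero integers $x,y,m$ with $m>0$. Then: (a) The equation $7x^2+59y^2=3^m$ has infinitely many primitive solutions. (b) The suitable positive integers are all odd and form precisely the arithmetic progression $m=10k+5$, $k=0,1,2,3,\ldots$ (c) For each given $m_0=10k_0+5$ (with $k_0\ge 0$ an integer) there is exactly one pp-solution of $7x^2+59y^2=3^m$ of the form $(x,y,m_0)$. (d) The first pp-solutions of $7x^2+59y^2=3^m$ (those with $m=5,15,25,35$) are $(1,2,5)$, $(701,430,15)$, $(262009,78842,25)$, $(78606773,10718566,35)$. (e) There is no solution $(x,y,m)$ of $7x^2+59y^2=3^m$ with $x$ even.
   Context: A solution of $7x^2+59y^2=3^m$ means a triple $(x,y,m)$ of non-zero integers with $m>0$ satisfying the equation. A solution $(x,y,m)$ is positive if $x>0$ and $y>0$, and primitive if $\gcd(x,y)=1$. A pp-solution is a solution that is both primitive and positive. A positive integer $m_0$ is called suitable if there is a primitive solution of the form $(x,y,m_0)$. *)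

theory Defs
  imports Complex_Main
begin

text \<open>The exponent is required to be a positive integer, so it is taken to be a natural number.\<close>

definition solution :: "int \<Rightarrow> int \<Rightarrow> nat \<Rightarrow> bool" where
  "solution x y m \<longleftrightarrow> x \<noteq> 0 \<and> y \<noteq> 0 \<and> m > 0 \<and> 7 * x ^ 2 + 59 * y ^ 2 = 3 ^ m"

definition primitive_solution :: "int \<Rightarrow> int \<Rightarrow> nat \<Rightarrow> bool" where
  "primitive_solution x y m \<longleftrightarrow> solution x y m \<and> gcd x y = 1"

definition positive_solution :: "int \<Rightarrow> int \<Rightarrow> nat \<Rightarrow> bool" where
  "positive_solution x y m \<longleftrightarrow> solution x y m \<and> x > 0 \<and> y > 0"

definition pp_solution :: "int \<Rightarrow> int \<Rightarrow> nat \<Rightarrow> bool" where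
  "pp_solution x y m \<longleftrightarrow> primitive_solution x y m \<and> positive_solution x y m"

definition suitable :: "nat \<Rightarrow> bool" where
  "suitable m \<longleftrightarrow> m > 0 \<and> (\<exists>x y. primitive_solution x y m)"

end

theory Submission
  imports Defs "HOL-Computational_Algebra.Primes"
begin

text \<open>
  In \<open>\<rat>(sqrt (-413))\<close> a primitive solution with exponent \<open>m\<close> says that the
  \<open>m\<close>-th power of a prime above 3 lies in the ideal class of the form \<open>7x\<^sup>2 + 59y\<^sup>2\<close>,
  a class of order 2. Since \<open>7 + 59 * 2\<^sup>2 = 3\<^sup>5\<close>, the fifth power lies there, the
  prime has order 10, and exactly the exponents \<open>10k + 5\<close> occur.

  The proof is an elementary descent that replaces the class group. Multiplication of
  \<open>x * sqrt 7 + y * sqrt (-59)\<close> by \<open>(sqrt 7 + 2 * sqrt (-59))\<^sup>2 = -229 + 4 * sqrt (-413)\<close>, an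
  element of norm \<open>3\<^sup>1\<^sup>0\<close>, becomes, after a change of signs, the integer matrix
  \<open>M = ((229, 236), (28, -229))\<close>. It multiplies \<open>7x\<^sup>2 + 59y\<^sup>2\<close> by \<open>3\<^sup>1\<^sup>0\<close> and satisfies
  \<open>M\<^sup>2 = 3\<^sup>1\<^sup>0\<close>, so \<open>M\<close> is, up to that factor, its own inverse.

  For a primitive solution with \<open>m \<ge> 10\<close>, exactly one of \<open>M(x, y)\<close>, \<open>M(x, -y)\<close> is
  divisible by \<open>3\<^sup>1\<^sup>0\<close>, and the quotient is a primitive solution with exponent
  \<open>m - 10\<close> (\<open>primitive_descent\<close>); the other choice of sign gives a primitive
  solution with exponent \<open>m + 10\<close> (\<open>primitive_ascent\<close>). The descent ends below 10,
  where \<open>(\<plusminus>1, \<plusminus>2, 5)\<close> is all there is (\<open>primitive_below_10\<close>). Since \<open>M\<close> is the identity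
  modulo 2, the parity of \<open>x\<close> is constant along the descent, so \<open>x\<close> is always odd; and
  since the sign used by \<open>M\<close> is forced modulo 3, the descent determines \<open>\<bar>x\<bar>\<close> and \<open>\<bar>y\<bar>\<close>
  from \<open>m\<close>. A solution that is not primitive is a power of 3 times a primitive one, which does
  not affect parity.
\<close>

section \<open>Congruences modulo 3 and 4\<close>

text \<open>Modulo 4 the equation reads \<open>3(x\<^sup>2 + y\<^sup>2) = (-1)\<^sup>m\<close>, and \<open>x\<^sup>2 + y\<^sup>2\<close> is never 3.\<close>

lemma odd_exponent:
  fixes x y :: int
  assumes eq: "7 * x^2 + 59 * y^2 = 3^m"
  shows "odd m"
proof
  assume "even m"
  then obtain k where "m = 2 * k" ..
  have sq: "\<exists>t. z^2 = 4 * t \<or> z^2 = 4 * t + 1" for z :: int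
  proof (cases "even z")
    case True
    then obtain t where "z = 2 * t" ..
    then have "z^2 = 4 * t^2" by simp
    then show ?thesis by blast
  next
    case False
    then obtain t where "z = 2 * t + 1" by (rule oddE)
    then have "z^2 = 4 * (t^2 + t) + 1" by (simp add: power2_eq_square algebra_simps)
    then show ?thesis by blast
  qed
  obtain s t where s: "x^2 = 4 * s \<or> x^2 = 4 * s + 1" and t: "y^2 = 4 * t \<or> y^2 = 4 * t + 1"
    using sq by meson
  have "(3::int)^m mod 4 = 1"
    using power_mod[of "9::int" 4 k] by (simp add: \<open>m = 2 * k\<close> power_mult)
  then obtain u where "(3::int)^m = 4 * u + 1"
    by (metis mult_div_mod_eq)
  with eq have "7 * x^2 + 59 * y^2 = 4 * u + 1" by simp
  \<comment> \<open>One value for each of the four choices of squares modulo 4: \<open>0 - 1\<close>, \<open>7 - 1\<close>, \<open>59 - 1\<close>, \<open>7 + 59 - 1\<close>.\<close>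
  with s t have "\<exists>w::int. 4 * w = - 1 \<or> 4 * w = 6 \<or> 4 * w = 58 \<or> 4 * w = 65"
    by (intro exI[of _ "u - 7 * s - 59 * t"]) (elim disjE; simp)
  then show False by presburger
qed

lemma three_dvd_iff:
  fixes x y :: int
  assumes eq: "7 * x^2 + 59 * y^2 = 3^m" and "m > 0"
  shows "3 dvd x \<longleftrightarrow> 3 dvd y"
proof -
  have "(x - y) * (x + y) = (7 * x^2 + 59 * y^2) - 3 * (2 * x^2 + 20 * y^2)"
    by (simp add: power2_eq_square algebra_simps)
  moreover have "3 dvd (7 * x^2 + 59 * y^2) - 3 * (2 * x^2 + 20 * y^2)"
    unfolding eq using \<open>m > 0\<close> by (intro dvd_diff dvd_triv_left) simp
  ultimately have "3 dvd (x - y) * (x + y)" by simp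
  moreover have "prime (3::int)" by simp
  ultimately have "3 dvd x - y \<or> 3 dvd x + y" using prime_dvd_mult_iff by blast
  then show ?thesis by presburger
qed

text \<open>A common prime factor of \<open>x\<close> and \<open>y\<close> divides \<open>3\<^sup>m\<close>, hence is 3; and then 3 divides both as
  soon as it divides one of them.\<close>

lemma primitive_solution_iff:
  "primitive_solution x y m \<longleftrightarrow> m > 0 \<and> 7 * x^2 + 59 * y^2 = 3^m \<and> \<not> 3 dvd x"
proof (intro iffI conjI)
  assume prim: "primitive_solution x y m"
  then show "m > 0" and eq: "7 * x^2 + 59 * y^2 = 3^m"
    by (auto simp: primitive_solution_def solution_def)
  show "\<not> 3 dvd x"
  proof
    assume "3 dvd x"
    moreover have "3 dvd y" using three_dvd_iff[OF eq \<open>m > 0\<close>] \<open>3 dvd x\<close> by simp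
    ultimately have "3 dvd gcd x y" by simp
    with prim show False by (simp add: primitive_solution_def)
  qed
next
  assume *: "m > 0 \<and> 7 * x^2 + 59 * y^2 = 3^m \<and> \<not> 3 dvd x"
  then have "x \<noteq> 0" by auto
  have "\<not> 3 dvd y" using * three_dvd_iff by blast
  then have "y \<noteq> 0" by auto
  have "coprime x y"
  proof (rule ccontr)
    assume "\<not> coprime x y"
    then have "\<not> is_unit (gcd x y)" by (simp add: coprime_iff_gcd_eq_1)
    moreover have "gcd x y \<noteq> 0" using \<open>x \<noteq> 0\<close> by simp
    ultimately obtain p where "prime p" "p dvd gcd x y" using prime_divisor_exists by blast
    then have p: "prime p" "p dvd x" "p dvd y" by simp_all
    then have "p dvd 7 * x^2 + 59 * y^2" by (simp add: power2_eq_square)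
    then have "p dvd 3" using * p(1) by (metis prime_dvd_power)
    moreover have "prime (3::int)" by simp
    ultimately have "p = 3" using p(1) primes_dvd_imp_eq by blast
    with p * show False by simp
  qed
  with * \<open>x \<noteq> 0\<close> \<open>y \<noteq> 0\<close> show "primitive_solution x y m"
    by (simp add: primitive_solution_def solution_def)
qed

lemma primitive_solutionD:
  assumes "primitive_solution x y m"
  shows "m > 0" "7 * x^2 + 59 * y^2 = 3^m" "\<not> 3 dvd x" "\<not> 3 dvd y" "odd m"
proof -
  show pos: "m > 0" and eq: "7 * x^2 + 59 * y^2 = 3^m" and n3: "\<not> 3 dvd x"
    using assms by (simp_all add: primitive_solution_iff)
  show "\<not> 3 dvd y" using n3 three_dvd_iff[OF eq pos] by simp
  show "odd m" using eq by (rule odd_exponent)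
qed

lemma primitive_solution_minus: "primitive_solution x (- y) m \<longleftrightarrow> primitive_solution x y m"
  by (simp add: primitive_solution_iff)

lemma pp_solution_iff: "pp_solution x y m \<longleftrightarrow> primitive_solution x y m \<and> x > 0 \<and> y > 0"
  by (auto simp: pp_solution_def positive_solution_def primitive_solution_def)

lemma coprime_three_power: "\<not> 3 dvd c \<Longrightarrow> coprime (3^k) (c :: int)"
  using prime_imp_coprime[of "3::int" c] by simp

lemma three_power_dvd_mult:
  fixes a b :: int
  assumes "3^k dvd a * b" and "\<not> (3 dvd a \<and> 3 dvd b)"
  shows "3^k dvd a \<or> 3^k dvd b"
  using assms coprime_three_power coprime_dvd_mult_left_iff coprime_dvd_mult_right_iff by metis

section \<open>The solutions with small exponent\<close>

text \<open>The equation gives \<open>59(y - 2x)(y + 2x) = 3\<^sup>m - 3\<^sup>5x\<^sup>2\<close>. So for \<open>m \<ge> 5\<close> one of the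
  two factors is divisible by \<open>3\<^sup>5\<close>, and for \<open>m < 10\<close> both are too small to be so without
  vanishing.\<close>

lemma primitive_below_10:
  assumes prim: "primitive_solution x y m" and "m < 10"
  shows "m = 5 \<and> \<bar>x\<bar> = 1 \<and> \<bar>y\<bar> = 2"
proof -
  note eq = primitive_solutionD(2)[OF prim]
  have "x \<noteq> 0" "y \<noteq> 0" using primitive_solutionD(3,4)[OF prim] by auto
  then have "x^2 \<ge> 1" "y^2 \<ge> 1" by (simp_all add: int_one_le_iff_zero_less)
  have "m \<ge> 5"
  proof (rule ccontr)
    assume "\<not> m \<ge> 5"
    with primitive_solutionD(5)[OF prim] have "m \<le> 3" by presburger
    then have "(3::int)^m \<le> 3^3" by (intro power_increasing) auto
    with eq \<open>x^2 \<ge> 1\<close> \<open>y^2 \<ge> 1\<close> show False by simp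
  qed
  have "59 * ((y - 2 * x) * (y + 2 * x)) = 3^m - 3^5 * x^2"
    using eq by (simp add: power2_eq_square algebra_simps)
  moreover have "(3::int)^5 dvd 3^m - 3^5 * x^2"
    using \<open>m \<ge> 5\<close> by (intro dvd_diff dvd_triv_left le_imp_power_dvd)
  ultimately have "3^5 dvd 59 * ((y - 2 * x) * (y + 2 * x))" by simp
  moreover have "coprime ((3::int)^5) 59"
    by (rule coprime_three_power) simp
  ultimately have "3^5 dvd (y - 2 * x) * (y + 2 * x)"
    using coprime_dvd_mult_right_iff by blast
  moreover have "\<not> (3 dvd y - 2 * x \<and> 3 dvd y + 2 * x)"
    using primitive_solutionD(3)[OF prim] by presburger
  ultimately have dvd: "3^5 dvd y - 2 * x \<or> 3^5 dvd y + 2 * x"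
    by (rule three_power_dvd_mult)
  have "(3::int)^m \<le> 3^9" using \<open>m < 10\<close> by (intro power_increasing) auto
  then have "y^2 \<le> 19^2" "x^2 \<le> 54^2" using eq \<open>x^2 \<ge> 1\<close> \<open>y^2 \<ge> 1\<close> by simp_all
  then have "\<bar>y\<bar> \<le> \<bar>19\<bar>" "\<bar>x\<bar> \<le> \<bar>54\<bar>" unfolding abs_le_square_iff .
  then have "\<bar>y - 2 * x\<bar> < 3^5" "\<bar>y + 2 * x\<bar> < 3^5" by auto
  moreover have "z = 0" if "3^5 dvd z" "\<bar>z\<bar> < 3^5" for z :: int
    using dvd_imp_le_int[of z "3^5"] that by force
  ultimately have "y - 2 * x = 0 \<or> y + 2 * x = 0" using dvd by blast
  then have y: "y = 2 * x \<or> y = - (2 * x)" by auto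
  then have "x dvd y" by auto
  with prim have "\<bar>x\<bar> = 1" by (auto simp: primitive_solution_def gcd_proj1_if_dvd_int)
  then have "x^2 = 1" by (simp add: power2_eq_1_iff abs_if split: if_splits)
  moreover have "y^2 = 4 * x^2" using y by (auto simp: power2_eq_square)
  ultimately have "(3::int)^m = 3^5" using eq by simp
  then have "m = 5" by (subst (asm) power_inject_exp) auto
  with y \<open>\<bar>x\<bar> = 1\<close> show ?thesis by auto
qed

section \<open>Descent and ascent by 10\<close>

lemma norm_identity:
  fixes X Y :: int
  shows "7 * (229 * X + 236 * Y)^2 + 59 * (28 * X - 229 * Y)^2 = 3^10 * (7 * X^2 + 59 * Y^2)"
  by (simp add: power2_eq_square algebra_simps)

lemma three_dvd_step_iff:
  fixes X Y :: int
  shows "3 dvd 229 * X + 236 * Y \<longleftrightarrow> 3 dvd X - Y"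
proof -
  have "229 * X + 236 * Y = (X - Y) + 3 * (76 * X + 79 * Y)" by simp
  then show ?thesis by (simp only: dvd_add_left_iff dvd_triv_left)
qed

text \<open>The product \<open>(229x + 236y)(229x - 236y)\<close> is \<open>3\<^sup>1\<^sup>0x\<^sup>2 - 944 * 3\<^sup>m\<close> on solutions,
  so one factor is divisible by \<open>3\<^sup>1\<^sup>0\<close>. The sign \<open>s\<close> selects it. Because \<open>M\<^sup>2 = 3\<^sup>1\<^sup>0\<close>, the
  second coordinate of \<open>M(x, s y)\<close> is then divisible by \<open>3\<^sup>1\<^sup>0\<close> too, and \<open>M\<close> takes the quotient
  \<open>(X, Y)\<close> back to \<open>(x, s y)\<close>.\<close>

lemma primitive_descent:
  assumes prim: "primitive_solution x y m" and "m \<ge> 10"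
  obtains X Y s where "s \<in> {1, -1}" "x = 229 * X + 236 * Y" "s * y = 28 * X - 229 * Y"
    "primitive_solution X Y (m - 10)"
proof -
  note eq = primitive_solutionD(2)[OF prim] and n3 = primitive_solutionD(3)[OF prim]
  have "(229 * x + 236 * y) * (229 * x - 236 * y)
      = 3^10 * x^2 - 944 * (7 * x^2 + 59 * y^2)"
    by (simp add: power2_eq_square algebra_simps)
  also have "\<dots> = 3^10 * x^2 - 944 * 3^m" by (simp only: eq)
  finally have "(229 * x + 236 * y) * (229 * x - 236 * y) = 3^10 * x^2 - 944 * 3^m" .
  moreover have "(3::int)^10 dvd 3^10 * x^2 - 944 * 3^m"
    using \<open>m \<ge> 10\<close> by (intro dvd_diff dvd_triv_left dvd_mult le_imp_power_dvd)
  ultimately have "3^10 dvd (229 * x + 236 * y) * (229 * x - 236 * y)" by simp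
  moreover have "\<not> (3 dvd 229 * x + 236 * y \<and> 3 dvd 229 * x - 236 * y)"
  proof -
    have "\<not> (3 dvd x - y \<and> 3 dvd x + y)" using n3 by presburger
    then show ?thesis using three_dvd_step_iff[of x y] three_dvd_step_iff[of x "- y"] by simp
  qed
  ultimately have "3^10 dvd 229 * x + 236 * y \<or> 3^10 dvd 229 * x - 236 * y"
    by (rule three_power_dvd_mult)
  then obtain s :: int where s: "s \<in> {1, -1}" and "3^10 dvd 229 * x + 236 * (s * y)"
  proof
    assume "3^10 dvd 229 * x + 236 * y"
    then show thesis by (intro that[of 1]) auto
  next
    assume "3^10 dvd 229 * x - 236 * y"
    then show thesis by (intro that[of "-1"]) auto
  qed
  then obtain X where X: "229 * x + 236 * (s * y) = 3^10 * X" by (elim dvdE)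
  have "229 * (28 * x - 229 * (s * y)) = 3^10 * (28 * X - s * y)"
    using X by (simp add: algebra_simps)
  then have "3^10 dvd 229 * (28 * x - 229 * (s * y))" by (rule dvdI)
  moreover have "coprime ((3::int)^10) 229"
    by (rule coprime_three_power) simp
  ultimately have "3^10 dvd 28 * x - 229 * (s * y)"
    using coprime_dvd_mult_right_iff by blast
  then obtain Y where Y: "28 * x - 229 * (s * y) = 3^10 * Y" by (elim dvdE)
  have x: "x = 229 * X + 236 * Y" and y: "s * y = 28 * X - 229 * Y"
    using X Y by simp_all
  have "(s * y)^2 = y^2" using s by auto
  with norm_identity[of X Y] eq have "3^10 * (7 * X^2 + 59 * Y^2) = 3^m"
    by (simp add: x y)
  also have "\<dots> = 3^10 * 3^(m - 10)" using \<open>m \<ge> 10\<close> power_add[of "3::int" 10 "m - 10"] by simp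
  finally have eq': "7 * X^2 + 59 * Y^2 = 3^(m - 10)" by simp
  then have "m - 10 > 0" using odd_exponent odd_pos by blast
  moreover have "\<not> 3 dvd X"
  proof
    assume "3 dvd X"
    moreover from this have "3 dvd Y" using three_dvd_iff[OF eq' \<open>m - 10 > 0\<close>] by simp
    ultimately show False using n3 x by simp
  qed
  ultimately have "primitive_solution X Y (m - 10)"
    using eq' by (simp add: primitive_solution_iff)
  with s x y show thesis by (rule that)
qed

text \<open>Modulo 3 the first coordinates of \<open>M(x, y)\<close> and \<open>M(x, -y)\<close> are \<open>x - y\<close> and \<open>x + y\<close>, which
  cannot both vanish.\<close>

lemma primitive_ascent:
  assumes prim: "primitive_solution x y m"
  shows "\<exists>x' y'. primitive_solution x' y' (m + 10)"
proof -
  have step: "primitive_solution (229 * x + 236 * z) (28 * x - 229 * z) (m + 10)"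
    if "primitive_solution x z m" "\<not> 3 dvd x - z" for z
  proof -
    have "7 * (229 * x + 236 * z)^2 + 59 * (28 * x - 229 * z)^2 = 3^(m + 10)"
      using norm_identity[of x z] primitive_solutionD(2)[OF that(1)] by (simp add: power_add)
    moreover have "\<not> 3 dvd 229 * x + 236 * z" using that(2) by (simp add: three_dvd_step_iff)
    ultimately show ?thesis by (simp add: primitive_solution_iff)
  qed
  have "\<not> 3 dvd x - y \<or> \<not> 3 dvd x - (- y)"
    using primitive_solutionD(3)[OF prim] by presburger
  then show ?thesis using step prim primitive_solution_minus by blast
qed

section \<open>Consequences of the descent\<close>

lemma primitive_exponent_and_parity:
  "primitive_solution x y m \<Longrightarrow> m mod 10 = 5 \<and> odd x"
proof (induction m arbitrary: x y rule: less_induct)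
  case (less m)
  show ?case
  proof (cases "m < 10")
    case True
    from primitive_below_10[OF less.prems True] show ?thesis by presburger
  next
    case False
    with less.prems obtain X Y s where x: "x = 229 * X + 236 * Y"
      and "primitive_solution X Y (m - 10)"
      using primitive_descent[of x y m] by (metis not_less)
    moreover have "m - 10 < m" using False by simp
    ultimately have "(m - 10) mod 10 = 5 \<and> odd X" using less.IH by blast
    with False x show ?thesis by (simp add: le_mod_geq)
  qed
qed

lemma primitive_exists: "\<exists>x y. primitive_solution x y (10 * k + 5)"
proof (induction k)
  case 0
  have "primitive_solution 1 2 5" by (simp add: primitive_solution_iff)
  then show ?case by auto
next
  case (Suc k)
  then obtain x y where "primitive_solution x y (10 * k + 5)" by blast
  from primitive_ascent[OF this] show ?case by (simp add: add_ac)
qed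

text \<open>Two solutions descend to \<open>(X, Y)\<close> and \<open>(X', Y')\<close>, equal up to signs by induction. Since 3
  divides \<open>(X - Y)(X + Y)\<close> but neither \<open>X - Y\<close> nor \<open>X' - Y'\<close>, which are \<open>x\<close> and \<open>x'\<close> modulo 3, the signs differ at most by
  a common factor, on which the absolute values of the coordinates of \<open>M(X, Y)\<close> do not depend.\<close>

lemma primitive_unique:
  "primitive_solution x y m \<Longrightarrow> primitive_solution x' y' m \<Longrightarrow> \<bar>x\<bar> = \<bar>x'\<bar> \<and> \<bar>y\<bar> = \<bar>y'\<bar>"
proof (induction m arbitrary: x y x' y' rule: less_induct)
  case (less m)
  show ?case
  proof (cases "m < 10")
    case True
    then show ?thesis using less.prems primitive_below_10 by metis
  next
    case False
    then have "m \<ge> 10" by simp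
    obtain X Y s where s: "s \<in> {1, -1}"
      and x: "x = 229 * X + 236 * Y" and y: "s * y = 28 * X - 229 * Y"
      and XY: "primitive_solution X Y (m - 10)"
      using primitive_descent[OF less.prems(1) \<open>m \<ge> 10\<close>] .
    obtain X' Y' s' where s': "s' \<in> {1, -1}"
      and x': "x' = 229 * X' + 236 * Y'" and y': "s' * y' = 28 * X' - 229 * Y'"
      and XY': "primitive_solution X' Y' (m - 10)"
      using primitive_descent[OF less.prems(2) \<open>m \<ge> 10\<close>] .
    have "\<bar>X\<bar> = \<bar>X'\<bar> \<and> \<bar>Y\<bar> = \<bar>Y'\<bar>" using less.IH[OF _ XY XY'] \<open>m \<ge> 10\<close> by simp
    moreover have "\<not> 3 dvd X - Y" "\<not> 3 dvd X' - Y'"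
      using primitive_solutionD(3)[OF less.prems(1)] primitive_solutionD(3)[OF less.prems(2)]
      by (simp_all add: x x' three_dvd_step_iff)
    moreover have "3 dvd X - Y \<or> 3 dvd X + Y"
      using primitive_solutionD(3,4)[OF XY] by presburger
    ultimately have "(X' = X \<and> Y' = Y) \<or> (X' = - X \<and> Y' = - Y)"
      by (smt (verit) dvd_minus_iff)
    then have "\<bar>x\<bar> = \<bar>x'\<bar>" "\<bar>s * y\<bar> = \<bar>s' * y'\<bar>" by (auto simp: x x' y y')
    then show ?thesis using s s' by (auto simp: abs_mult)
  qed
qed

lemma pp_unique:
  "pp_solution x y m \<Longrightarrow> pp_solution x' y' m \<Longrightarrow> x = x' \<and> y = y'"
  using primitive_unique[of x y m x' y'] by (simp add: pp_solution_iff)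

lemma pp_exists: "\<exists>x y. pp_solution x y (10 * k + 5)"
proof -
  obtain x y where prim: "primitive_solution x y (10 * k + 5)" using primitive_exists by blast
  then have "x \<noteq> 0" "y \<noteq> 0" using primitive_solutionD(3,4)[OF prim] by auto
  moreover have "primitive_solution \<bar>x\<bar> \<bar>y\<bar> (10 * k + 5)"
    using prim by (simp add: primitive_solution_iff)
  ultimately have "pp_solution \<bar>x\<bar> \<bar>y\<bar> (10 * k + 5)" by (simp add: pp_solution_iff)
  then show ?thesis by blast
qed

lemma suitable_iff: "suitable m \<longleftrightarrow> (\<exists>k. m = 10 * k + 5)"
proof
  assume "suitable m"
  then have "m mod 10 = 5" using primitive_exponent_and_parity by (auto simp: suitable_def)
  then show "\<exists>k. m = 10 * k + 5" by presburger
next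
  assume "\<exists>k. m = 10 * k + 5"
  then show "suitable m" using primitive_exists by (auto simp: suitable_def)
qed

text \<open>The only possible common prime factor is 3, which is odd: dividing it out preserves the parity
  of \<open>x\<close> and leads to a primitive solution.\<close>

lemma solution_odd: "solution x y m \<Longrightarrow> odd x"
proof (induction m arbitrary: x y rule: less_induct)
  case (less m)
  then have eq: "7 * x^2 + 59 * y^2 = 3^m" and nz: "x \<noteq> 0" "y \<noteq> 0" and "m > 0"
    by (auto simp: solution_def)
  show ?case
  proof (cases "3 dvd x")
    case False
    with eq \<open>m > 0\<close> have "primitive_solution x y m" by (simp add: primitive_solution_iff)
    then show ?thesis using primitive_exponent_and_parity by blast
  next
    case True
    then have "3 dvd y" using three_dvd_iff[OF eq \<open>m > 0\<close>] by simp
    with True obtain a b where x: "x = 3 * a" and y: "y = 3 * b" by (elim dvdE)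
    have eq9: "9 * (7 * a^2 + 59 * b^2) = 3^m" using eq by (simp add: x y power_mult_distrib)
    have "(9::int) dvd 3^m" by (simp flip: eq9)
    then have "m \<noteq> 1" by auto
    with \<open>m > 0\<close> have "m \<ge> 2" by simp
    then have "(3::int)^m = 3^2 * 3^(m - 2)" by (simp only: le_add_diff_inverse flip: power_add)
    with eq9 have eq': "7 * a^2 + 59 * b^2 = 3^(m - 2)" by simp
    have "m - 2 > 0" using odd_exponent[OF eq'] odd_pos by blast
    then have "solution a b (m - 2)"
      using nz eq' by (simp add: solution_def x y)
    then have "odd a" using less.IH[of "m - 2"] \<open>m > 0\<close> by simp
    then show ?thesis by (simp add: x)
  qed
qed

lemma pp_solutions_upto_35:
  "{(x, y, m). pp_solution x y m \<and> m \<le> 35} =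
    {(1, 2, 5), (701, 430, 15), (262009, 78842, 25), (78606773, 10718566, 35)}"
    (is "?A = ?B")
proof
  have pp: "pp_solution 1 2 5" "pp_solution 701 430 15" "pp_solution 262009 78842 25"
    "pp_solution 78606773 10718566 35"
    by (simp_all add: pp_solution_iff primitive_solution_iff)
  then show "?B \<subseteq> ?A" by auto
  have "(x, y, m) \<in> ?B" if sol: "pp_solution x y m" and "m \<le> 35" for x y m
  proof -
    have "m mod 10 = 5"
      using sol primitive_exponent_and_parity by (auto simp: pp_solution_iff)
    with \<open>m \<le> 35\<close> have "m \<in> {5, 15, 25, 35}" unfolding insert_iff empty_iff by presburger
    with pp sol show ?thesis by (elim insertE emptyE) (auto dest: pp_unique)
  qed
  then show "?A \<subseteq> ?B" by blast
qed

theorem mainTheorem1: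
  shows "infinite {(x, y, m). primitive_solution x y m} \<and>
    ((\<forall>m. suitable m \<longrightarrow> odd m) \<and> {m. suitable m} = {10 * k + 5 | k. True}) \<and>
    (\<forall>k\<^sub>0 :: nat. \<exists>!(x, y). pp_solution x y (10 * k\<^sub>0 + 5)) \<and>
    {(x, y, m). pp_solution x y m \<and> m \<le> 35} =
      {(1, 2, 5), (701, 430, 15), (262009, 78842, 25), (78606773, 10718566, 35)} \<and>
    \<not> (\<exists>x y m. solution x y m \<and> even x)"
proof (intro conjI)
  have "range (\<lambda>k. 10 * k + 5) \<subseteq> (\<lambda>(x, y, m). m) ` {(x, y, m). primitive_solution x y m}"
  proof (rule image_subsetI)
    fix k
    obtain x y where "primitive_solution x y (10 * k + 5)" using primitive_exists by blast
    then show "10 * k + 5 \<in> (\<lambda>(x, y, m). m) ` {(x, y, m). primitive_solution x y m}"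
      by (intro image_eqI[of _ _ "(x, y, 10 * k + 5)"]) auto
  qed
  moreover have "infinite (range (\<lambda>k::nat. 10 * k + 5))"
    by (simp add: finite_image_iff inj_on_def)
  ultimately show "infinite {(x, y, m). primitive_solution x y m}"
    by (meson finite_imageI finite_subset)
  show "\<forall>m. suitable m \<longrightarrow> odd m" by (auto simp: suitable_iff)
  show "{m. suitable m} = {10 * k + 5 | k. True}" by (auto simp: suitable_iff)
  show "\<forall>k\<^sub>0 :: nat. \<exists>!(x, y). pp_solution x y (10 * k\<^sub>0 + 5)"
  proof
    fix k\<^sub>0 :: nat
    obtain x y where "pp_solution x y (10 * k\<^sub>0 + 5)" using pp_exists by blast
    then show "\<exists>!(x, y). pp_solution x y (10 * k\<^sub>0 + 5)"
      by (intro ex1I[of _ "(x, y)"]) (auto dest: pp_unique)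
  qed
  show "{(x, y, m). pp_solution x y m \<and> m \<le> 35} =
      {(1, 2, 5), (701, 430, 15), (262009, 78842, 25), (78606773, 10718566, 35)}"
    by (rule pp_solutions_upto_35)
  show "\<not> (\<exists>x y m. solution x y m \<and> even x)" using solution_odd by blast
qed

end
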